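(* Let $m, n$ be integers with $1 \leq m \leq n$, and let $k$ be an integer. Then there exist binary strings $x, y \in \{{\tt 0},{\tt 1}\}^*$ with $|x| = m$, $|y| = n$ and $f(x,y) = k$ if and only if all of the following conditions hold: (a) $0 \leq k \leq m+n$; (b) $k$ is even; (c) if $(m+n)/\gcd(m,n)$ is odd, then $k \leq m + n - \gcd(m,n)$.
   Context: $|w|$ is the length of a string $w$; $xy$ denotes the concatenation of $x$ and $y$. For strings $u, v$ of equal length, the Hamming distance $h(u,v)$ is the number of positions in which $u$ and $v$ differ. For strings $x, y$ (not necessarily of the same length), $f(x,y) = h(xy, yx)$. *)

theory Defs
  imports Main
begin

(* Only meant for lists of equal length. *)
definition hamming_dist :: "'a list \<Rightarrow> 'a list \<Rightarrow> nat" where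
  "hamming_dist u v = card {i. i < length u \<and> u ! i \<noteq> v ! i}"

definition comm_dist :: "'a list \<Rightarrow> 'a list \<Rightarrow> nat" where
  "comm_dist x y = hamming_dist (x @ y) (y @ x)"

(* The binary alphabet {0,1} is represented by the two-element type bool. *)
type_synonym binary_string = "bool list"

end

theory Submission
  imports Defs "HOL-Number_Theory.Cong"
begin

text \<open>
  Put \<open>N = m + n\<close>, \<open>g = gcd m n\<close>, \<open>L = N div g\<close>. Then \<open>f(x,y)\<close> counts the positions at which
  \<open>w = xy\<close> differs from its cyclic shift by \<open>m\<close>. If \<open>B\<close> is the set of ones of \<open>w\<close>, as many
  positions leave \<open>B\<close> under the shift as enter it, so the count is even. The shift has one orbit of
  length \<open>L\<close> per residue class modulo \<open>g\<close>; when \<open>L\<close> is odd, \<open>w\<close> cannot alternate along an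
  orbit, so each of the \<open>g\<close> orbits loses a position. Conversely, the set of every second point of
  every orbit (\<open>L div 2\<close> points each) is disjoint from its shift, and a word whose ones form a
  subset of size \<open>k / 2\<close> of it realises \<open>k\<close>.
\<close>

text \<open>As \<open>\<sigma>\<close> permutes \<open>S\<close>, equally many \<open>i\<close>
  satisfy \<open>P (\<sigma> i)\<close> and \<open>P i\<close>. Cancelling the \<open>i\<close> that
  satisfy both leaves as many entries into \<open>P\<close> as exits from it.\<close>

lemma card_changes_bij:
  assumes "finite S" and bij: "bij_betw \<sigma> S S"
  shows "card {i \<in> S. P i \<noteq> P (\<sigma> i)} = 2 * card {i \<in> S. P i \<and> \<not> P (\<sigma> i)}"
proof -
  let ?O = "{i \<in> S. P i \<and> \<not> P (\<sigma> i)}" and ?I = "{i \<in> S. \<not> P i \<and> P (\<sigma> i)}"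
    and ?B = "{i \<in> S. P i \<and> P (\<sigma> i)}"
  have "bij_betw \<sigma> {i \<in> S. P (\<sigma> i)} {i \<in> S. P i}"
    using bij by (auto simp: bij_betw_def inj_on_def image_iff)
  then have "card {i \<in> S. P (\<sigma> i)} = card {i \<in> S. P i}"
    by (rule bij_betw_same_card)
  moreover have "{i \<in> S. P (\<sigma> i)} = ?I \<union> ?B" "{i \<in> S. P i} = ?O \<union> ?B"
    by auto
  moreover have "card (?I \<union> ?B) = card ?I + card ?B" "card (?O \<union> ?B) = card ?O + card ?B"
    using \<open>finite S\<close> by (auto intro!: card_Un_disjoint)
  ultimately have "card ?I = card ?O"
    by simp
  moreover have "{i \<in> S. P i \<noteq> P (\<sigma> i)} = ?O \<union> ?I"
    by auto
  moreover have "card (?O \<union> ?I) = card ?O + card ?I"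
    using \<open>finite S\<close> by (auto intro!: card_Un_disjoint)
  ultimately show ?thesis
    by simp
qed

lemma bij_betw_add_mod:
  fixes m N :: nat
  shows "bij_betw (\<lambda>i. (i + m) mod N) {..<N} {..<N}"
proof -
  have "inj_on (\<lambda>i. (i + m) mod N) {..<N}"
  proof (rule inj_onI)
    fix i j assume "i \<in> {..<N}" "j \<in> {..<N}" "(i + m) mod N = (j + m) mod N"
    then have "[i = j] (mod N)"
      by (simp flip: cong_def add: cong_add_rcancel_nat)
    with \<open>i \<in> _\<close> \<open>j \<in> _\<close> show "i = j"
      by (simp add: cong_less_modulus_unique_nat)
  qed
  moreover have "(\<lambda>i. (i + m) mod N) ` {..<N} \<subseteq> {..<N}"
    by auto
  ultimately show ?thesis
    by (simp add: bij_betw_def endo_inj_surj)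
qed

text \<open>Rotating \<open>x @ y\<close> left by \<open>m\<close> letters gives
  \<open>y @ x\<close>, so the distance compares one word with its own cyclic shift.\<close>

lemma comm_dist_eq_card_shift:
  assumes "length x = m" "length y = n"
  shows "comm_dist x y =
    card {i \<in> {..<m + n}. (x @ y) ! i \<noteq> (x @ y) ! ((i + m) mod (m + n))}"
proof -
  have "(y @ x) ! i = (x @ y) ! ((i + m) mod (m + n))" if "i < m + n" for i
  proof (cases "i < n")
    case True
    then show ?thesis using assms by (simp add: nth_append)
  next
    case False
    then have "(i + m) mod (m + n) = i - n"
      using that by (simp add: mod_if)
    then show ?thesis using assms that False by (auto simp: nth_append)
  qed
  then show ?thesis
    using assms by (auto simp: comm_dist_def hamming_dist_def intro!: arg_cong[where f = card])
qed

text \<open>Reduction modulo \<open>g\<close> recovers \<open>r\<close>, because \<open>g\<close>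
  divides both \<open>m\<close> and \<open>N\<close>. Once \<open>r\<close> is cancelled and the
  congruence is divided by \<open>g\<close>, the factor \<open>m div g\<close> is coprime to
  \<open>N div g\<close>, so \<open>a\<close> is determined modulo \<open>N div g\<close>.\<close>

lemma orbit_coordinates_inj:
  fixes m n :: nat
  defines "N \<equiv> m + n" and "g \<equiv> gcd m n"
  assumes "0 < m" and eq: "(r + a * m) mod N = (s + b * m) mod N"
    and "r < g" "s < g" "a < N div g" "b < N div g"
  shows "r = s \<and> a = b"
proof -
  have "g > 0" "g dvd m" "g dvd N"
    using \<open>0 < m\<close> by (auto simp: g_def N_def)
  obtain m' n' where m': "m = g * m'" and n': "n = g * n'" and "coprime m' n'"
    unfolding g_def using gcd_coprime_exists[of m n] \<open>0 < m\<close> by (auto simp: mult.commute)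
  have N: "N = g * (m' + n')"
    by (simp add: N_def m' n' distrib_left)
  then have L: "N div g = m' + n'"
    using \<open>g > 0\<close> by simp
  have "((r + a * m) mod N) mod g = ((s + b * m) mod N) mod g"
    using eq by simp
  then have "(r + a * m) mod g = (s + b * m) mod g"
    using \<open>g dvd N\<close> by (simp add: mod_mod_cancel)
  then have "r mod g = s mod g"
    using \<open>g dvd m\<close> by (auto simp: mult.left_commute[of _ g])
  then have "r = s"
    using \<open>r < g\<close> \<open>s < g\<close> by simp
  with eq have "[a * m = b * m] (mod N)"
    by (simp flip: cong_def add: cong_add_lcancel_nat)
  then have "[g * (a * m') = g * (b * m')] (mod g * (m' + n'))"
    unfolding m' N by (simp only: mult.left_commute)
  then have "g * ((a * m') mod (m' + n')) = g * ((b * m') mod (m' + n'))"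
    by (simp only: cong_def mult_mod_right)
  then have "[a * m' = b * m'] (mod (m' + n'))"
    using \<open>g > 0\<close> by (simp add: cong_def)
  moreover have "coprime m' (m' + n')"
    using \<open>coprime m' n'\<close> by (simp only: coprime_iff_gcd_eq_1 gcd_add2)
  ultimately have "[a = b] (mod (m' + n'))"
    by (simp add: cong_mult_rcancel_nat)
  then have "a = b"
    using assms(7,8) L by (simp add: cong_less_modulus_unique_nat)
  with \<open>r = s\<close> show ?thesis by simp
qed

text \<open>Otherwise each step of the orbit flips \<open>P\<close>; but \<open>N div g\<close>
  steps, an odd number, lead back to the start.\<close>

lemma no_alternation_along_odd_orbit:
  fixes m n :: nat and P :: "nat \<Rightarrow> bool"
  defines "N \<equiv> m + n" and "g \<equiv> gcd m n"
  assumes odd: "odd (N div g)"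
  shows "\<exists>j. P ((r + j * m) mod N) = P (((r + j * m) mod N + m) mod N)"
proof (rule ccontr)
  assume no_fix: "\<not> ?thesis"
  have step: "P ((r + Suc j * m) mod N) \<longleftrightarrow> \<not> P ((r + j * m) mod N)" for j
  proof -
    have "(r + Suc j * m) mod N = ((r + j * m) mod N + m) mod N"
      by (simp add: mod_add_right_eq ac_simps)
    then show ?thesis
      using no_fix by metis
  qed
  have alt: "P ((r + j * m) mod N) \<longleftrightarrow> (P (r mod N) \<longleftrightarrow> even j)" for j
  proof (induction j)
    case (Suc j)
    then show ?case unfolding step by simp
  qed simp
  have "g dvd N" "g dvd m"
    by (simp_all add: N_def g_def)
  \<comment> \<open>The total displacement after \<open>N div g\<close> steps is a multiple of
    \<open>N\<close>: the orbit closes.\<close>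
  then have "N div g * m = N * (m div g)"
    by (metis div_mult_swap dvd_div_mult)
  then have "(r + N div g * m) mod N = r mod N"
    by simp
  with alt[of "N div g"] odd show False
    by simp
qed

text \<open>Each orbit stays in one residue class modulo \<open>g\<close>, so the unchanged
  positions found on the orbits of the \<open>g\<close> residues are distinct:
  \<open>i mod g\<close> maps the unchanged positions onto \<open>{..<g}\<close>.\<close>

lemma card_changes_shift_le:
  fixes m n :: nat and P :: "nat \<Rightarrow> bool"
  defines "N \<equiv> m + n" and "g \<equiv> gcd m n"
  assumes "0 < m" and odd: "odd (N div g)"
  shows "card {i \<in> {..<N}. P i \<noteq> P ((i + m) mod N)} + g \<le> N"
proof -
  let ?C = "{i \<in> {..<N}. P i \<noteq> P ((i + m) mod N)}"
    and ?E = "{i \<in> {..<N}. P i = P ((i + m) mod N)}"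
  have "N > 0"
    using \<open>0 < m\<close> by (simp add: N_def)
  have "r \<in> (\<lambda>i. i mod g) ` ?E" if "r < g" for r
  proof -
    obtain j where j: "P ((r + j * m) mod N) = P (((r + j * m) mod N + m) mod N)"
      using no_alternation_along_odd_orbit[OF odd[unfolded N_def g_def]] unfolding N_def by blast
    have "g dvd N" "g dvd m"
      by (simp_all add: N_def g_def)
    then have "((r + j * m) mod N) mod g = (r + j * m) mod g"
      by (simp add: mod_mod_cancel)
    also have "\<dots> = r"
      using \<open>g dvd m\<close> that by (auto simp: mult.left_commute[of _ g])
    finally show ?thesis
      using j \<open>N > 0\<close> by (intro image_eqI[where x = "(r + j * m) mod N"]) auto
  qed
  then have "{..<g} \<subseteq> (\<lambda>i. i mod g) ` ?E"
    by auto
  then have "card {..<g} \<le> card ?E"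
    by (rule surj_card_le[rotated]) simp
  moreover have "card ?C + card ?E = card (?C \<union> ?E)"
    by (rule card_Un_disjoint[symmetric]) auto
  moreover have "?C \<union> ?E = {..<N}"
    by auto
  ultimately show ?thesis
    by simp
qed

lemma exists_shift_independent_set:
  fixes m n :: nat
  defines "N \<equiv> m + n" and "g \<equiv> gcd m n"
  assumes "0 < m"
  obtains A where "A \<subseteq> {..<N}" "card A = g * (N div g div 2)"
    "\<And>i. i \<in> A \<Longrightarrow> (i + m) mod N \<notin> A"
proof
  \<comment> \<open>These are the points of even index on each orbit. For odd \<open>N div g\<close>
    the bound on \<open>j\<close> leaves out the last index \<open>N div g - 1\<close>, whose
    successor would be the chosen point of index 0.\<close>
  let ?p = "\<lambda>(r, j). (r + 2 * j * m) mod N" and ?D = "{..<g} \<times> {..<N div g div 2}"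
  note inj = orbit_coordinates_inj[OF \<open>0 < m\<close>, of _ _ n, folded N_def g_def]
  show "?p ` ?D \<subseteq> {..<N}"
    using \<open>0 < m\<close> by (auto simp: N_def)
  have "inj_on ?p ?D"
  proof (rule inj_onI, clarify)
    fix r j s k
    assume "r < g" "s < g" "j < N div g div 2" "k < N div g div 2"
      and "(r + 2 * j * m) mod N = (s + 2 * k * m) mod N"
    then show "r = s \<and> j = k"
      using inj[of r "2 * j" s "2 * k"] by linarith
  qed
  then show "card (?p ` ?D) = g * (N div g div 2)"
    by (simp add: card_image)
  fix i assume "i \<in> ?p ` ?D"
  then obtain r j where r: "r < g" and j: "j < N div g div 2" and i: "i = (r + 2 * j * m) mod N"
    by auto
  show "(i + m) mod N \<notin> ?p ` ?D"
  proof
    assume "(i + m) mod N \<in> ?p ` ?D"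
    then obtain s k where s: "s < g" and k: "k < N div g div 2"
      and "(i + m) mod N = (s + 2 * k * m) mod N"
      by auto
    then have "(r + (2 * j + 1) * m) mod N = (s + 2 * k * m) mod N"
      by (simp add: i mod_add_right_eq algebra_simps)
    \<comment> \<open>The successor's index does not wrap around, so uniqueness of coordinates would
      equate an odd index with an even one.\<close>
    moreover have "2 * j + 1 < N div g" "2 * k < N div g"
      using j k by linarith+
    ultimately have "2 * j + 1 = 2 * k"
      using inj r s by blast
    then show False
      by presburger
  qed
qed

lemma exists_comm_dist:
  fixes m n :: nat
  assumes "0 < m" and q: "q \<le> gcd m n * ((m + n) div gcd m n div 2)"
  shows "\<exists>x y :: binary_string. length x = m \<and> length y = n \<and> comm_dist x y = 2 * q"
proof -
  let ?N = "m + n"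
  obtain A where A: "A \<subseteq> {..<?N}" "card A = gcd m n * (?N div gcd m n div 2)"
    and indep: "\<And>i. i \<in> A \<Longrightarrow> (i + m) mod ?N \<notin> A"
    using exists_shift_independent_set[OF \<open>0 < m\<close>] by metis
  obtain B where B: "B \<subseteq> A" "card B = q"
    using obtain_subset_with_card_n q A(2) by metis
  define w where "w = map (\<lambda>i. i \<in> B) [0..<?N]"
  have w: "w ! i \<longleftrightarrow> i \<in> B" if "i < ?N" for i
    using that by (simp add: w_def)
  have "comm_dist (take m w) (drop m w) =
      card {i \<in> {..<?N}. w ! i \<noteq> w ! ((i + m) mod ?N)}"
    using comm_dist_eq_card_shift[of "take m w" m "drop m w" n] by (simp add: w_def)
  also have "\<dots> = 2 * card {i \<in> {..<?N}. w ! i \<and> \<not> w ! ((i + m) mod ?N)}"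
    by (rule card_changes_bij) (simp_all add: bij_betw_add_mod)
  \<comment> \<open>The shift takes each point of \<open>B\<close> outside \<open>A\<close>, hence
    outside \<open>B\<close>, so every one in \<open>w\<close> counts as an exit.\<close>
  also have "{i \<in> {..<?N}. w ! i \<and> \<not> w ! ((i + m) mod ?N)} = B"
    using B(1) A(1) indep \<open>0 < m\<close> by (auto simp: w)
  finally have "comm_dist (take m w) (drop m w) = 2 * q"
    using B(2) by simp
  moreover have "length (take m w) = m" "length (drop m w) = n"
    by (simp_all add: w_def)
  ultimately show ?thesis
    by blast
qed

theorem theorem2:
  fixes m n :: nat and k :: int
  assumes "1 \<le> m" and "m \<le> n"
  shows "(\<exists>x y :: binary_string. length x = m \<and> length y = n \<and> int (comm_dist x y) = k) \<longleftrightarrow>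
    (0 \<le> k \<and> k \<le> int m + int n) \<and>
    even k \<and>
    (odd ((m + n) div gcd m n) \<longrightarrow> k \<le> int m + int n - int (gcd m n))"
    (is "?L \<longleftrightarrow> ?R")
proof
  assume ?L
  then obtain x y :: binary_string
    where len: "length x = m" "length y = n" and k: "k = int (comm_dist x y)"
    by blast
  define w where "w = x @ y"
  let ?C = "{i \<in> {..<m + n}. w ! i \<noteq> w ! ((i + m) mod (m + n))}"
  have dist: "comm_dist x y = card ?C"
    unfolding w_def by (rule comm_dist_eq_card_shift[OF len])
  have "card ?C \<le> card {..<m + n}"
    by (rule card_mono) auto
  moreover have "even (card ?C)"
    by (subst card_changes_bij) (simp_all add: bij_betw_add_mod)
  moreover have "card ?C + gcd m n \<le> m + n" if "odd ((m + n) div gcd m n)"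
    using card_changes_shift_le[of m n "(!) w"] that assms by simp
  ultimately show ?R
    unfolding k dist by auto
next
  assume ?R
  then obtain q where k: "k = int (2 * q)"
    by (metis even_of_nat_iff evenE nonneg_int_cases)
  define g L where "g = gcd m n" and "L = (m + n) div g"
  have N: "m + n = g * L"
    unfolding g_def L_def by (rule dvd_mult_div_cancel[symmetric]) simp
  \<comment> \<open>For even \<open>L\<close> this is half of \<open>k \<le> m + n\<close>. For odd
    \<open>L\<close>, \<open>g * (L div 2)\<close> is half of \<open>m + n - g\<close>, which is the
    bound in the third condition.\<close>
  have "q \<le> g * (L div 2)"
  proof (cases "even L")
    case True
    then obtain l where "L = 2 * l" by (rule evenE)
    moreover have "2 * q \<le> g * L"
      using \<open>?R\<close> unfolding k N[symmetric] by linarith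
    ultimately show ?thesis
      by simp
  next
    case False
    then obtain l where l: "L = 2 * l + 1" by (rule oddE)
    have "2 * q + g \<le> g * L"
      using \<open>?R\<close> False unfolding k N[symmetric] unfolding L_def g_def by linarith
    then show ?thesis
      by (simp add: l)
  qed
  then have "\<exists>x y :: binary_string. length x = m \<and> length y = n \<and> comm_dist x y = 2 * q"
    unfolding g_def L_def using assms by (intro exists_comm_dist) simp_all
  then show ?L
    unfolding k of_nat_eq_iff .
qed

end
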